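(* For all integers $n\geq 0$ and $i\geq 1$, $$\bar a_{9i}(9n+6)\equiv 0 \pmod{12},\qquad \bar a_{9i+4}(9n+6)\equiv 0\pmod{12},\qquad \bar a_{9i+8}(9n+6)\equiv 0\pmod{12}.$$
   Context: For an integer $k\geq 1$ let $f_k:=\prod_{n\geq 1}(1-q^{kn})$. For an integer $c\geq1$, the generalized overcubic partition function $\bar a_c(n)$ is defined by the generating function $\sum_{n\geq 0}\bar a_c(n)q^n=\dfrac{f_4^{c-1}}{f_1^2f_2^{2c-3}}$. *)

theory Defs
  imports "HOL-Computational_Algebra.Formal_Power_Series"
begin

text \<open>The infinite product f_k = prod_{n>=1} (1 - q^(k n)) as a formal power series
  over the rationals: its m-th coefficient equals the m-th coefficient of the
  finite product over 1 <= n <= m (later factors do not affect it when k >= 1).\<close>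
definition eta_f :: "nat \<Rightarrow> rat fps" where
  "eta_f k = Abs_fps (\<lambda>m. fps_nth (\<Prod>n\<in>{1..m}. (1 - fps_X ^ (k * n))) m)"

text \<open>Generating function f_4^(c-1) / (f_1^2 f_2^(2c-3)); for c = 1 the exponent
  2c-3 = -1, so the series is f_2 / f_1^2.\<close>
definition overcubic_gf :: "nat \<Rightarrow> rat fps" where
  "overcubic_gf c =
     (if c = 1 then eta_f 2 * inverse (eta_f 1 ^ 2)
      else eta_f 4 ^ (c - 1) * inverse (eta_f 1 ^ 2 * eta_f 2 ^ (2 * c - 3)))"

definition abar :: "nat \<Rightarrow> nat \<Rightarrow> rat" where
  "abar c n = fps_nth (overcubic_gf c) n"

end

theory Submission
  imports Defs
begin

text \<open>Let x = \<phi>(-q), y = \<phi>(-q^2) and z = \<phi>(q), where \<phi> is the theta series of the squares.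
  Gauss' identity x = f_1^2 / f_2 turns the generating function into G = 1 / (x y^(c-1)).
  Moreover x z = y^2.

  Modulo 4 we have x^2 = y^2 = 1, so G is congruent to x or to x + y - 1, and 9n+6 is neither a
  square nor twice a square.

  Modulo 3 cubing is the substitution q \<mapsto> q^3, and

    \<^item> G y^(3(3i+1)) = x z^2 for c = 9i,
    \<^item> G (x y^(3i+1))^3 = x^2 for c = 9i+4,
    \<^item> G y^(9(i+1)) = z for c = 9i+8.

  Keeping the exponents divisible by 3, and dividing them by 3, turns the right-hand sides into
  x y y(q^3), x(q^3)^2 and z(q^3) modulo 3. After clearing further cubes, what remains is x or z or 1
  times a series in q^3, and no square is congruent to 2 modulo 3. The evaluation of the part
  of x z^2 rests on the lattice of triples of integers that are congruent modulo 3, which is an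
  orthogonal sum of a line and a hexagonal lattice.\<close>

unbundle fps_syntax

section \<open>Power series modulo an integer and lattice theta series\<close>

lemma fps_nth_compose_X_power:
  fixes f :: "'a::comm_ring_1 fps"
  assumes "k > 0"
  shows "(f oo fps_X ^ k) $ n = (if k dvd n then f $ (n div k) else 0)"
proof -
  have "(f oo fps_X ^ k) $ n = (\<Sum>i=0..n. if n = k * i then f $ i else 0)"
    by (auto simp: fps_compose_nth simp flip: power_mult intro!: sum.cong)
  also have "\<dots> = (if k dvd n then f $ (n div k) else 0)"
  proof (cases "k dvd n")
    case True
    then obtain m where m: "n = k * m" by blast
    have "(n = k * i) = (m = i)" for i using assms m by auto
    moreover have "m \<le> n" using assms m by simp
    ultimately show ?thesis using True m assms by (simp add: sum.delta)
  next
    case False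
    then show ?thesis by (intro trans[OF sum.neutral]) auto
  qed
  finally show ?thesis .
qed

text \<open>Congruences between series are stated throughout as divisibility in the ring
  \<open>int fps\<close>, so that ring reasoning applies. This is the passage to coefficients and
  back.\<close>

lemma numeral_dvd_fps_iff:
  "(numeral d :: int fps) dvd F \<longleftrightarrow> (\<forall>n. numeral d dvd F $ n)"
proof
  assume "numeral d dvd F"
  then show "\<forall>n. numeral d dvd F $ n"
    by (auto simp: dvd_def numeral_fps_const)
next
  assume "\<forall>n. numeral d dvd F $ n"
  then have "F = numeral d * Abs_fps (\<lambda>n. F $ n div numeral d)"
    by (intro fps_ext) (simp add: numeral_fps_const)
  then show "numeral d dvd F" by (rule dvdI)
qed

lemma fps_X_power_dvd_iff:
  fixes F :: "'a::comm_ring_1 fps"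
  shows "fps_X ^ n dvd F \<longleftrightarrow> (\<forall>j<n. F $ j = 0)"
proof
  assume "fps_X ^ n dvd F"
  then show "\<forall>j<n. F $ j = 0"
    by (auto simp: dvd_def fps_X_power_mult_nth)
next
  assume "\<forall>j<n. F $ j = 0"
  then have "F = fps_X ^ n * fps_shift n F"
    by (intro fps_ext) (auto simp: fps_X_power_mult_nth)
  then show "fps_X ^ n dvd F" by (rule dvdI)
qed

text \<open>A series with constant coefficient 1 is a unit, even over a ring that is not a
  field.\<close>

lemma dvd_mult_fps_unit_cancel:
  fixes F g :: "'a::comm_ring_1 fps"
  assumes "d dvd F * g" and "g $ 0 = 1"
  shows "d dvd F"
proof -
  have "F * g * fps_right_inverse g 1 = F"
    using fps_right_inverse[of g 1] assms(2) by (simp add: mult.assoc)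
  then show ?thesis using assms(1) by (metis dvd_mult2)
qed

text \<open>The Frobenius map modulo 3. Write f = c + q g: the mixed terms of the cube carry a
  factor 3, c^3 and c agree modulo 3 by Fermat, and what is left is the same claim for g, three
  exponents lower.\<close>

lemma fps_cube_cong_compose_X_cube:
  fixes f :: "int fps"
  shows "3 dvd f ^ 3 - (f oo fps_X ^ 3)"
proof -
  have "3 dvd (f ^ 3 - (f oo fps_X ^ 3)) $ n" for n
  proof (induction n arbitrary: f rule: less_induct)
    case (less n)
    define c g where "c = f $ 0" and "g = fps_shift 1 f"
    have f: "f = fps_const c + fps_X * g"
      by (rule fps_ext) (auto simp: c_def g_def)
    have "f ^ 3 = fps_const (c ^ 3) + fps_X ^ 3 * g ^ 3 +
        3 * (fps_const c * fps_X * g * (fps_const c + fps_X * g))"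
      unfolding f by (simp add: power3_eq_cube algebra_simps flip: fps_const_power)
    moreover have "f oo fps_X ^ 3 = fps_const c + fps_X ^ 3 * (g oo fps_X ^ 3)"
      unfolding f by (simp add: fps_compose_add_distrib fps_compose_mult_distrib)
    ultimately have eq: "f ^ 3 - (f oo fps_X ^ 3) = fps_const (c ^ 3 - c) +
        fps_X ^ 3 * (g ^ 3 - (g oo fps_X ^ 3)) +
        3 * (fps_const c * fps_X * g * (fps_const c + fps_X * g))"
      by (simp add: algebra_simps flip: fps_const_sub)
    have "c ^ 3 - c = (c - 1) * c * (c + 1)"
      by (simp add: algebra_simps power3_eq_cube)
    moreover have "3 dvd (c - 1) * c * (c + 1)"
    proof -
      have "3 dvd c - 1 \<or> 3 dvd c \<or> 3 dvd c + 1" by presburger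
      then show ?thesis by auto
    qed
    ultimately have "3 dvd fps_const (c ^ 3 - c) $ n" by simp
    moreover have "3 dvd (fps_X ^ 3 * (g ^ 3 - (g oo fps_X ^ 3))) $ n"
      using less.IH[of "n - 3" g] by (auto simp: fps_X_power_mult_nth)
    moreover have "3 dvd (3 * (fps_const c * fps_X * g * (fps_const c + fps_X * g))) $ n"
      using numeral_dvd_fps_iff dvd_triv_left by blast
    ultimately show ?case unfolding eq fps_add_nth by (intro dvd_add)
  qed
  then show ?thesis by (simp add: numeral_dvd_fps_iff)
qed

text \<open>One component of the \<open>m\<close>-dissection of a series; for r = 0 it is the
  operator U_m of the theory of modular forms.\<close>

definition fps_section :: "nat \<Rightarrow> nat \<Rightarrow> 'a fps \<Rightarrow> 'a fps" where
  "fps_section m r F = Abs_fps (\<lambda>n. F $ (m * n + r))"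

lemma fps_section_nth: "fps_section m r F $ n = F $ (m * n + r)"
  by (simp add: fps_section_def)

text \<open>Multiplication by a series in q^m preserves residue classes of exponents modulo m, so
  such a factor can be pulled out of a section.\<close>

lemma fps_section_mult_compose:
  fixes F g :: "'a::comm_ring_1 fps"
  assumes "r < m"
  shows "fps_section m r (F * (g oo fps_X ^ m)) = fps_section m r F * g"
proof (rule fps_ext)
  fix n
  let ?S = "(\<lambda>j. m * j + r) ` {0..n}"
  have "(F * (g oo fps_X ^ m)) $ (m * n + r) =
      (\<Sum>i=0..m * n + r. F $ i * (g oo fps_X ^ m) $ (m * n + r - i))"
    by (simp add: fps_mult_nth)
  also have "\<dots> = (\<Sum>i\<in>?S. F $ i * (g oo fps_X ^ m) $ (m * n + r - i))"
  proof (rule sum.mono_neutral_right)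
    show "?S \<subseteq> {0..m * n + r}" by auto
    show "\<forall>i\<in>{0..m * n + r} - ?S. F $ i * (g oo fps_X ^ m) $ (m * n + r - i) = 0"
    proof
      fix i assume i: "i \<in> {0..m * n + r} - ?S"
      have "\<not> m dvd m * n + r - i"
      proof
        assume "m dvd m * n + r - i"
        then obtain k where k: "m * n + r - i = m * k" by blast
        \<comment> \<open>Here \<open>r < m\<close> rules out k = n + 1, so that i is one of the
          indices in \<open>?S\<close>.\<close>
        then have "m * k \<le> m * n + r" by linarith
        then have "m * k < m * Suc n" using assms by simp
        then have "k \<le> n" by (simp only: mult_less_cancel1) simp
        then have "i = m * (n - k) + r"
          using k i by (auto simp: diff_mult_distrib2)
        then show False using i by auto
      qed
      then show "F $ i * (g oo fps_X ^ m) $ (m * n + r - i) = 0"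
        using assms by (simp add: fps_nth_compose_X_power)
    qed
  qed simp
  also have "\<dots> = (\<Sum>j=0..n. F $ (m * j + r) * (g oo fps_X ^ m) $ (m * n + r - (m * j + r)))"
    using assms by (subst sum.reindex) (auto simp: inj_on_def)
  also have "\<dots> = (fps_section m r F * g) $ n"
    unfolding fps_mult_nth
  proof (rule sum.cong)
    fix j assume "j \<in> {0..n}"
    have "m * n + r - (m * j + r) = m * (n - j)" by (simp add: diff_mult_distrib2)
    then show "F $ (m * j + r) * (g oo fps_X ^ m) $ (m * n + r - (m * j + r)) =
        fps_section m r F $ j * g $ (n - j)"
      using assms by (simp add: fps_nth_compose_X_power fps_section_nth)
  qed simp
  finally show "fps_section m r (F * (g oo fps_X ^ m)) $ n = (fps_section m r F * g) $ n"
    by (simp add: fps_section_nth)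
qed

text \<open>Modulo 3 the cube of f is f(q^3), which leaves the section as f. Each use extracts a
  residue class of exponents and lowers the power of f from 3 to 1.\<close>

lemma cong_cube_section:
  fixes F G f :: "int fps"
  assumes "3 dvd G * f ^ 3 - F" and "r < 3"
  shows "3 dvd fps_section 3 r G * f - fps_section 3 r F"
proof -
  have "G * (f oo fps_X ^ 3) - F = (G * f ^ 3 - F) - G * (f ^ 3 - (f oo fps_X ^ 3))"
    by (simp add: algebra_simps)
  then have "3 dvd G * (f oo fps_X ^ 3) - F"
    using assms(1) fps_cube_cong_compose_X_cube[of f] by (metis dvd_diff dvd_mult)
  moreover have "(fps_section 3 r G * f - fps_section 3 r F) $ n =
      (G * (f oo fps_X ^ 3) - F) $ (3 * n + r)" for n
    using assms(2) by (simp add: fps_section_nth flip: fps_section_mult_compose)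
  ultimately show ?thesis by (simp add: numeral_dvd_fps_iff del: fps_sub_nth)
qed

text \<open>The index type is arbitrary, so that products of theta series become theta series over
  pairs and triples. A sum over an infinite fibre of \<open>Q\<close> is 0 by convention, hence the
  finiteness hypotheses for products.\<close>

definition lattice_theta :: "('a \<Rightarrow> nat) \<Rightarrow> ('a \<Rightarrow> int) \<Rightarrow> int fps" where
  "lattice_theta Q w = Abs_fps (\<lambda>n. \<Sum>v | Q v = n. w v)"

lemma lattice_theta_mult:
  assumes "\<And>n. finite {u. Q u = n}" "\<And>n. finite {v. R v = n}"
  shows "lattice_theta Q w * lattice_theta R w' =
    lattice_theta (\<lambda>(u, v). Q u + R v) (\<lambda>(u, v). w u * w' v)"
proof (rule fps_ext)
  fix n
  have "(\<Sum>p | (case p of (u, v) \<Rightarrow> Q u + R v) = n. case p of (u, v) \<Rightarrow> w u * w' v) =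
    (\<Sum>p\<in>(SIGMA i:{0..n}. {u. Q u = i} \<times> {v. R v = n - i}). case p of (i, u, v) \<Rightarrow> w u * w' v)"
    by (rule sum.reindex_bij_witness[of _ snd "\<lambda>(u, v). (Q u, u, v)"]) auto
  also have "\<dots> = (\<Sum>i=0..n. \<Sum>(u, v)\<in>{u. Q u = i} \<times> {v. R v = n - i}. w u * w' v)"
    using assms by (subst sum.Sigma) (auto simp: case_prod_unfold)
  also have "\<dots> = (lattice_theta Q w * lattice_theta R w') $ n"
    by (simp add: fps_mult_nth lattice_theta_def sum_product sum.cartesian_product)
  finally show "(lattice_theta Q w * lattice_theta R w') $ n =
      lattice_theta (\<lambda>(u, v). Q u + R v) (\<lambda>(u, v). w u * w' v) $ n"
    by (simp add: lattice_theta_def)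
qed

lemma finite_fibre_add:
  assumes "\<And>n. finite {u. Q u = n}" "\<And>n. finite {v. R v = n}"
  shows "finite {p. (case p of (u, v) \<Rightarrow> Q u + R v) = (n::nat)}"
proof (rule finite_subset)
  show "{p. (case p of (u, v) \<Rightarrow> Q u + R v) = n} \<subseteq>
      (\<Union>i\<le>n. {u. Q u = i}) \<times> (\<Union>i\<le>n. {v. R v = i})"
    by auto
  show "finite ((\<Union>i\<le>n. {u. Q u = i}) \<times> (\<Union>i\<le>n. {v. R v = i}))"
    using assms by blast
qed

lemma lattice_theta_compose_X_power:
  assumes "k > 0"
  shows "lattice_theta Q w oo fps_X ^ k = lattice_theta (\<lambda>v. k * Q v) w"
proof (rule fps_ext)
  fix n
  show "(lattice_theta Q w oo fps_X ^ k) $ n = lattice_theta (\<lambda>v. k * Q v) w $ n"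
  proof (cases "k dvd n")
    case True
    then obtain m where "n = k * m" by blast
    with assms show ?thesis by (simp add: fps_nth_compose_X_power lattice_theta_def)
  next
    case False
    then have "{v. k * Q v = n} = {}" by auto
    with False assms show ?thesis by (simp add: fps_nth_compose_X_power lattice_theta_def)
  qed
qed

section \<open>The theta series of the squares\<close>

text \<open>This is (-1)^a, also for negative a.\<close>

definition parity_sign :: "int \<Rightarrow> int" where
  "parity_sign a = (if even a then 1 else -1)"

lemma parity_sign_add: "parity_sign (a + b) = parity_sign a * parity_sign b"
  by (auto simp: parity_sign_def)

lemma parity_sign_minus [simp]: "parity_sign (- a) = parity_sign a"
  by (simp add: parity_sign_def)

definition phi :: "int fps" where
  "phi = lattice_theta (\<lambda>a::int. nat (a\<^sup>2)) (\<lambda>_. 1)"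

text \<open>The series \<phi>(-q), because a and its square have the same parity.\<close>

definition phi_neg :: "int fps" where
  "phi_neg = lattice_theta (\<lambda>a::int. nat (a\<^sup>2)) parity_sign"

lemma nat_square_eq_iff: "nat (a\<^sup>2) = n \<longleftrightarrow> a\<^sup>2 = int n"
  by auto

lemma abs_le_square: "\<bar>a\<bar> \<le> (a::int)\<^sup>2"
  by (metis abs_ge_zero int_one_le_iff_zero_less le_less mult_cancel_right1 power2_abs
      power2_eq_square self_le_power zero_less_numeral)

lemma finite_square_fibre: "k > 0 \<Longrightarrow> finite {a::int. k * nat (a\<^sup>2) = n}"
proof (rule finite_subset)
  assume k: "k > 0"
  show "{a::int. k * nat (a\<^sup>2) = n} \<subseteq> {- int n..int n}"
  proof
    fix a :: int assume "a \<in> {a. k * nat (a\<^sup>2) = n}"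
    then have "k * nat (a\<^sup>2) = n" by simp
    then have "nat (a\<^sup>2) \<le> n" using k by auto
    then have "a\<^sup>2 \<le> int n" by linarith
    moreover have "\<bar>a\<bar> \<le> a\<^sup>2" by (rule abs_le_square)
    ultimately show "a \<in> {- int n..int n}" by auto
  qed
qed simp

text \<open>A rewrite rule that moves fibre conditions from \<open>nat\<close> to
  \<open>int\<close>; its uses remove \<open>of_nat_eq_iff\<close> from the simplifier to avoid a
  loop.\<close>

lemma nat_eq_iff_int_eq: "m = n \<longleftrightarrow> int m = int n"
  by simp

lemmas finite_square_fibre_1 = finite_square_fibre[of 1, simplified]

lemma phi_nth_eq_0:
  assumes "\<And>a::int. a\<^sup>2 \<noteq> int n"
  shows "phi $ n = 0" "phi_neg $ n = 0"
  using assms by (auto simp: phi_def phi_neg_def lattice_theta_def nat_square_eq_iff)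

lemma phi_neg_nth_0 [simp]: "phi_neg $ 0 = 1"
  by (simp add: phi_neg_def lattice_theta_def parity_sign_def)

text \<open>If n is even, a and b have the same parity, and u = (a+b)/2, v = (b-a)/2 satisfy a^2 +
  b^2 = 2(u^2 + v^2). The sign of a = u - v is the product of the signs of u and v.\<close>

lemma phi_mult_phi_neg: "phi_neg * phi = (phi_neg oo fps_X\<^sup>2)\<^sup>2"
proof (rule fps_ext)
  fix n
  have "(phi_neg * phi) $ n = (\<Sum>(a, b) | a\<^sup>2 + b\<^sup>2 = int n. parity_sign a)"
    unfolding phi_def phi_neg_def
    by (subst lattice_theta_mult[OF finite_square_fibre_1 finite_square_fibre_1])
      (auto simp: lattice_theta_def nat_eq_iff_int_eq simp del: of_nat_eq_iff intro!: sum.cong)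
  also have "\<dots> = (\<Sum>(a, b) | 2 * (a\<^sup>2 + b\<^sup>2) = int n. parity_sign a * parity_sign b)"
  proof (cases "even n")
    case True
    then have same: "even (a + b)" "even (a - b)" if "a\<^sup>2 + b\<^sup>2 = int n" for a b
    proof -
      have "even (a\<^sup>2 + b\<^sup>2)" using that True by simp
      then show "even (a + b)" "even (a - b)" by auto
    qed
    show ?thesis
    proof (rule sum.reindex_bij_witness[of _ "\<lambda>(u, v). (u - v, u + v)"
          "\<lambda>(a, b). ((a + b) div 2, (b - a) div 2)"], goal_cases)
      case (1 p)
      then obtain a b where p: "p = (a, b)" "a\<^sup>2 + b\<^sup>2 = int n" by auto
      then obtain k where "a + b = 2 * k" using same(1)[OF p(2)] by (elim evenE)
      then have "b = 2 * k - a" by simp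
      then show ?case using p by simp
    next
      case (2 p)
      then obtain a b where p: "p = (a, b)" "a\<^sup>2 + b\<^sup>2 = int n" by auto
      then obtain k where "a + b = 2 * k" using same(1)[OF p(2)] by (elim evenE)
      then have b: "b = 2 * k - a" by simp
      have "(a + b) div 2 = k" "(b - a) div 2 = k - a" unfolding b by simp_all
      then show ?case using p(2) unfolding p(1) b
        by (simp add: power2_eq_square algebra_simps)
    next
      case (3 p)
      then show ?case by auto
    next
      case (4 p)
      then show ?case by (auto simp: power2_eq_square algebra_simps)
    next
      case (5 p)
      then obtain a b where p: "p = (a, b)" "a\<^sup>2 + b\<^sup>2 = int n" by auto
      then obtain k where "a + b = 2 * k" using same(1)[OF p(2)] by (elim evenE)
      then have "b = 2 * k - a" by simp
      then show ?case using p by (auto simp: parity_sign_def)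
    qed
  next
    case False
    \<comment> \<open>For odd n the right-hand side is empty. On the left a and b have opposite
      parities, so swapping them shows that the sum is its own negative.\<close>
    have "(\<Sum>(a, b) | a\<^sup>2 + b\<^sup>2 = int n. parity_sign a) =
        (\<Sum>(a, b) | a\<^sup>2 + b\<^sup>2 = int n. parity_sign b)"
      by (rule sum.reindex_bij_witness[of _ prod.swap prod.swap]) (auto simp: add.commute)
    also have "\<dots> = (\<Sum>(a, b) | a\<^sup>2 + b\<^sup>2 = int n. - parity_sign a)"
    proof (rule sum.cong, simp, clarify)
      fix a b :: int assume "a\<^sup>2 + b\<^sup>2 = int n"
      then have "odd (a\<^sup>2 + b\<^sup>2)" using False by simp
      then show "parity_sign b = - parity_sign a" by (auto simp: parity_sign_def)
    qed
    also have "\<dots> = - (\<Sum>(a, b) | a\<^sup>2 + b\<^sup>2 = int n. parity_sign a)"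
      by (simp add: sum_negf case_prod_unfold)
    finally have "(\<Sum>(a, b) | a\<^sup>2 + b\<^sup>2 = int n. parity_sign a) = 0" by simp
    moreover have "2 * (a\<^sup>2 + b\<^sup>2) \<noteq> int n" for a b :: int
      using False by presburger
    ultimately show ?thesis by simp
  qed
  also have "\<dots> = ((phi_neg oo fps_X\<^sup>2)\<^sup>2) $ n"
    unfolding phi_neg_def lattice_theta_compose_X_power[OF zero_less_numeral]
      power2_eq_square[of "lattice_theta _ _"]
    by (subst lattice_theta_mult[OF finite_square_fibre finite_square_fibre])
      (auto simp: lattice_theta_def nat_eq_iff_int_eq simp del: of_nat_eq_iff intro!: sum.cong)
  finally show "(phi_neg * phi) $ n = ((phi_neg oo fps_X\<^sup>2)\<^sup>2) $ n" .
qed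

section \<open>Sums of three squares divisible by 3\<close>

lemma sum_filter_split:
  fixes w :: "'a \<Rightarrow> int"
  assumes "finite A"
  shows "sum w {v \<in> A. P v} = sum w {v \<in> A. P v \<and> R v} + sum w {v \<in> A. P v \<and> \<not> R v}"
  using assms by (subst sum.union_disjoint[symmetric]) (auto intro!: sum.cong)

lemma not_dvd_3_iff: "\<not> 3 dvd (a::int) \<longleftrightarrow> a mod 3 = 1 \<or> a mod 3 = 2"
  by presburger

lemma square_mod_3: "(a::int)\<^sup>2 mod 3 = (if 3 dvd a then 0 else 1)"
proof (cases "3 dvd a")
  case True
  then show ?thesis by (auto simp: power2_eq_square)
next
  case False
  then have "a mod 3 = 1 \<or> a mod 3 = 2" by (simp only: not_dvd_3_iff)
  moreover have "a\<^sup>2 mod 3 = (a mod 3)\<^sup>2 mod 3" by (simp add: power_mod)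
  ultimately show ?thesis using False by auto
qed

lemma finite_three_squares: "finite {(a, b, c). (a::int)\<^sup>2 + b\<^sup>2 + c\<^sup>2 = int n}"
proof -
  have "finite {v. (case v of (a::int, v) \<Rightarrow> nat (a\<^sup>2) +
      (case v of (b::int, c::int) \<Rightarrow> nat (b\<^sup>2) + nat (c\<^sup>2))) = n}"
    by (intro finite_fibre_add finite_square_fibre_1)
  also have "{v. (case v of (a::int, v) \<Rightarrow> nat (a\<^sup>2) +
      (case v of (b::int, c::int) \<Rightarrow> nat (b\<^sup>2) + nat (c\<^sup>2))) = n} =
      {(a, b, c). (a::int)\<^sup>2 + b\<^sup>2 + c\<^sup>2 = int n}"
    by (auto simp: nat_eq_iff_int_eq simp del: of_nat_eq_iff)
  finally show ?thesis .
qed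

text \<open>Changes of sign preserve the weight and split the triples prime to 3 into eight residue
  classes with equal sums N. Only two of these classes are diagonal, so with the sum Z over the
  triples divisible by 3 the two sides are Z + 8N and Z + 2N, which differ by 6N.\<close>

lemma three_squares_sum_cong:
  defines "T \<equiv> \<lambda>n. {(a, b, c). a\<^sup>2 + b\<^sup>2 + c\<^sup>2 = 3 * int n}"
  shows "3 dvd (\<Sum>(a, b, c)\<in>T n. parity_sign a) -
    (\<Sum>(a, b, c) | (a, b, c) \<in> T n \<and> a mod 3 = b mod 3 \<and> b mod 3 = c mod 3. parity_sign a)"
proof -
  define w where "w = (\<lambda>(a, b::int, c::int). parity_sign a)"
  define S where "S = (\<lambda>P. sum w {v \<in> T n. case v of (a, b, c) \<Rightarrow> P a b c})"
  have fin: "finite (T n)"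
    using finite_three_squares[of "3 * n"] by (simp add: T_def)
  have split: "S P = S (\<lambda>a b c. P a b c \<and> R a b c) + S (\<lambda>a b c. P a b c \<and> \<not> R a b c)" for P R
    unfolding S_def
    by (subst sum_filter_split[OF fin, where R = "\<lambda>(a, b, c). R a b c"])
      (auto intro!: arg_cong2[where f = "(+)"] sum.cong)
  have cong: "S P = S P'" if "\<And>a b c. (a, b, c) \<in> T n \<Longrightarrow> P a b c = P' a b c" for P P'
    unfolding S_def using that by (intro sum.cong) auto
  have flip_a: "S (\<lambda>a b c. P a b c) = S (\<lambda>a b c. P (- a) b c)" for P
    unfolding S_def
    by (rule sum.reindex_bij_witness[of _ "\<lambda>(a, b, c). (- a, b, c)" "\<lambda>(a, b, c). (- a, b, c)"])
      (auto simp: T_def w_def)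
  have flip_b: "S (\<lambda>a b c. P a b c) = S (\<lambda>a b c. P a (- b) c)" for P
    unfolding S_def
    by (rule sum.reindex_bij_witness[of _ "\<lambda>(a, b, c). (a, - b, c)" "\<lambda>(a, b, c). (a, - b, c)"])
      (auto simp: T_def w_def)
  have flip_c: "S (\<lambda>a b c. P a b c) = S (\<lambda>a b c. P a b (- c))" for P
    unfolding S_def
    by (rule sum.reindex_bij_witness[of _ "\<lambda>(a, b, c). (a, b, - c)" "\<lambda>(a, b, c). (a, b, - c)"])
      (auto simp: T_def w_def)
  have neg2: "(- a) mod 3 = 2 \<longleftrightarrow> a mod 3 = 1" for a :: int by presburger
  define N where "N = S (\<lambda>a b c. a mod 3 = 1 \<and> b mod 3 = 1 \<and> c mod 3 = 1)"
  define Z where "Z = S (\<lambda>a b c. a mod 3 = 0 \<and> b mod 3 = 0 \<and> c mod 3 = 0)"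
  \<comment> \<open>Squares are 0 or 1 modulo 3, and three such values have a sum divisible by 3
    only if they are equal.\<close>
  have alldiv: "(3 dvd a \<longleftrightarrow> 3 dvd b) \<and> (3 dvd b \<longleftrightarrow> 3 dvd c)" if "(a, b, c) \<in> T n" for a b c
  proof -
    have "(a\<^sup>2 mod 3 + b\<^sup>2 mod 3 + c\<^sup>2 mod 3) mod 3 = (a\<^sup>2 + b\<^sup>2 + c\<^sup>2) mod 3"
      by (metis mod_add_eq mod_add_left_eq)
    also have "\<dots> = 0" using that by (simp add: T_def)
    finally show ?thesis by (auto simp: square_mod_3 split: if_splits)
  qed
  have "S (\<lambda>a b c. True) = Z + S (\<lambda>a b c. \<not> 3 dvd a \<and> \<not> 3 dvd b \<and> \<not> 3 dvd c)"
    unfolding Z_def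
    by (subst split[where R = "\<lambda>a b c. 3 dvd a"])
      (auto intro!: arg_cong2[where f = "(+)"] cong dest: alldiv)
  also have "S (\<lambda>a b c. \<not> 3 dvd a \<and> \<not> 3 dvd b \<and> \<not> 3 dvd c) =
      2 * S (\<lambda>a b c. a mod 3 = 1 \<and> \<not> 3 dvd b \<and> \<not> 3 dvd c)"
  proof -
    have "S (\<lambda>a b c. \<not> 3 dvd a \<and> \<not> 3 dvd b \<and> \<not> 3 dvd c) =
        S (\<lambda>a b c. a mod 3 = 1 \<and> \<not> 3 dvd b \<and> \<not> 3 dvd c) +
        S (\<lambda>a b c. a mod 3 = 2 \<and> \<not> 3 dvd b \<and> \<not> 3 dvd c)"
      by (subst split[where R = "\<lambda>a b c. a mod 3 = 1"])
        (intro arg_cong2[where f = "(+)"] cong; auto simp: not_dvd_3_iff)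
    \<comment> \<open>The third occurrence of \<open>S\<close> is the class of residue 2, which the
      change of sign carries to residue 1.\<close>
    then show ?thesis by (subst (asm) (3) flip_a) (simp add: neg2)
  qed
  also have "S (\<lambda>a b c. a mod 3 = 1 \<and> \<not> 3 dvd b \<and> \<not> 3 dvd c) =
      2 * S (\<lambda>a b c. a mod 3 = 1 \<and> b mod 3 = 1 \<and> \<not> 3 dvd c)"
  proof -
    have "S (\<lambda>a b c. a mod 3 = 1 \<and> \<not> 3 dvd b \<and> \<not> 3 dvd c) =
        S (\<lambda>a b c. a mod 3 = 1 \<and> b mod 3 = 1 \<and> \<not> 3 dvd c) +
        S (\<lambda>a b c. a mod 3 = 1 \<and> b mod 3 = 2 \<and> \<not> 3 dvd c)"
      by (subst split[where R = "\<lambda>a b c. b mod 3 = 1"])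
        (intro arg_cong2[where f = "(+)"] cong; auto simp: not_dvd_3_iff)
    then show ?thesis by (subst (asm) (3) flip_b) (simp add: neg2)
  qed
  also have "S (\<lambda>a b c. a mod 3 = 1 \<and> b mod 3 = 1 \<and> \<not> 3 dvd c) = 2 * N"
  proof -
    have "S (\<lambda>a b c. a mod 3 = 1 \<and> b mod 3 = 1 \<and> \<not> 3 dvd c) =
        N + S (\<lambda>a b c. a mod 3 = 1 \<and> b mod 3 = 1 \<and> c mod 3 = 2)"
      unfolding N_def
      by (subst split[where R = "\<lambda>a b c. c mod 3 = 1"])
        (intro arg_cong2[where f = "(+)"] cong; auto simp: not_dvd_3_iff)
    then show ?thesis by (subst (asm) (2) flip_c) (simp add: neg2 N_def)
  qed
  finally have all: "S (\<lambda>a b c. True) = Z + 8 * N" by simp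
  have "S (\<lambda>a b c. a mod 3 = b mod 3 \<and> b mod 3 = c mod 3) =
      Z + S (\<lambda>a b c. a mod 3 = b mod 3 \<and> b mod 3 = c mod 3 \<and> \<not> 3 dvd a)"
    unfolding Z_def
    by (subst split[where R = "\<lambda>a b c. 3 dvd a"]) (intro arg_cong2[where f = "(+)"] cong; auto)
  also have "S (\<lambda>a b c. a mod 3 = b mod 3 \<and> b mod 3 = c mod 3 \<and> \<not> 3 dvd a) =
      N + S (\<lambda>a b c. a mod 3 = 2 \<and> b mod 3 = 2 \<and> c mod 3 = 2)"
    unfolding N_def
    by (subst split[where R = "\<lambda>a b c. a mod 3 = 1"])
      (intro arg_cong2[where f = "(+)"] cong; auto simp: not_dvd_3_iff)
  also have "S (\<lambda>a b c. a mod 3 = 2 \<and> b mod 3 = 2 \<and> c mod 3 = 2) = N"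
    unfolding N_def by (subst flip_a, subst flip_b, subst flip_c) (simp add: neg2)
  finally have diag: "S (\<lambda>a b c. a mod 3 = b mod 3 \<and> b mod 3 = c mod 3) = Z + 2 * N" by simp
  have "(\<Sum>(a, b, c)\<in>T n. parity_sign a) = Z + 8 * N"
    unfolding all[symmetric] S_def w_def by (intro sum.cong) auto
  moreover have "(\<Sum>(a, b, c) | (a, b, c) \<in> T n \<and> a mod 3 = b mod 3 \<and> b mod 3 = c mod 3.
      parity_sign a) = Z + 2 * N"
    unfolding diag[symmetric] S_def w_def by (intro sum.cong) auto
  ultimately show ?thesis by simp
qed

text \<open>The orthogonal splitting of the lattice of congruent triples: s is the mean and spans
  the line, while p and t are thirds of differences and give the hexagonal form p^2 + pt + t^2. The
  sign is that of a = s - 2p - t.\<close>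

lemma three_squares_diagonal_sum:
  "(\<Sum>(a, b, c) | a\<^sup>2 + b\<^sup>2 + c\<^sup>2 = 3 * int n \<and> a mod 3 = b mod 3 \<and> b mod 3 = c mod 3.
      parity_sign a) =
    (\<Sum>(s, p, t) | s\<^sup>2 + 2 * (p\<^sup>2 + p * t + t\<^sup>2) = int n. parity_sign (s + t))"
proof (rule sum.reindex_bij_witness[of _ "\<lambda>(s, p, t). (s - 2 * p - t, s + p + 2 * t, s + p - t)"
      "\<lambda>(a, b, c). ((a + b + c) div 3, (c - a) div 3, (b - c) div 3)"], goal_cases)
  case (1 v)
  then obtain a b c where v: "v = (a, b, c)" "a mod 3 = b mod 3" "b mod 3 = c mod 3" by auto
  then have "3 dvd c - a" "3 dvd b - c" by presburger+
  then obtain p t where "c - a = 3 * p" "b - c = 3 * t" by (auto elim!: dvdE)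
  then have "c = a + 3 * p" "b = a + 3 * p + 3 * t" by auto
  then show ?case by (simp add: v)
next
  case (2 v)
  then obtain a b c where v: "v = (a, b, c)" "a mod 3 = b mod 3" "b mod 3 = c mod 3"
    "a\<^sup>2 + b\<^sup>2 + c\<^sup>2 = 3 * int n" by auto
  then have "3 dvd c - a" "3 dvd b - c" by presburger+
  then obtain p t where "c - a = 3 * p" "b - c = 3 * t" by (auto elim!: dvdE)
  then have "c = a + 3 * p" "b = a + 3 * p + 3 * t" by auto
  then show ?case using v(4) by (simp add: v(1) power2_eq_square algebra_simps)
next
  case (3 v)
  then show ?case by auto
next
  case (4 v)
  then obtain s p t where v: "v = (s, p, t)" "s\<^sup>2 + 2 * (p\<^sup>2 + p * t + t\<^sup>2) = int n" by auto
  have "s + p + 2 * t = s - 2 * p - t + 3 * (p + t)" "s + p + 2 * t = s + p - t + 3 * t" by simp_all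
  then have "(s - 2 * p - t) mod 3 = (s + p + 2 * t) mod 3"
    "(s + p + 2 * t) mod 3 = (s + p - t) mod 3"
    by (metis mod_mult_self2)+
  then show ?case using v by (simp add: power2_eq_square algebra_simps)
next
  case (5 v)
  then obtain a b c where v: "v = (a, b, c)" "a mod 3 = b mod 3" "b mod 3 = c mod 3" by auto
  then have "3 dvd c - a" "3 dvd b - c" by presburger+
  then obtain p t where "c - a = 3 * p" "b - c = 3 * t" by (auto elim!: dvdE)
  then have "c = a + 3 * p" "b = a + 3 * p + 3 * t" by auto
  then show ?case by (auto simp: v parity_sign_def)
qed

text \<open>The rotation (p, t) \<mapsto> (t, -p-t) of the hexagonal lattice has order three and permutes
  its three nonzero classes modulo 2 cyclically, so these classes have equal sums.\<close>
lemma eisenstein_sign_sum: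
  defines "M \<equiv> \<lambda>n. {(s, p, t). s\<^sup>2 + 2 * (p\<^sup>2 + p * t + t\<^sup>2) = int n}"
  shows "(\<Sum>(s, p, t)\<in>M n. parity_sign (s + t)) =
    (\<Sum>(s, p, t) | (s, p, t) \<in> M n \<and> even t. parity_sign (s + p))"
proof -
  \<comment> \<open>Finiteness is inherited from sums of three squares through the same change of
    coordinates.\<close>
  have "M n \<subseteq> (\<lambda>(a, b, c). ((a + b + c) div 3, (c - a) div 3, (b - c) div 3)) `
      {(a, b, c). a\<^sup>2 + b\<^sup>2 + c\<^sup>2 = int (3 * n)}"
  proof
    fix v assume "v \<in> M n"
    then obtain s p t where v: "v = (s, p, t)" "s\<^sup>2 + 2 * (p\<^sup>2 + p * t + t\<^sup>2) = int n"
      by (auto simp: M_def)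
    then have "(s - 2 * p - t)\<^sup>2 + (s + p + 2 * t)\<^sup>2 + (s + p - t)\<^sup>2 = int (3 * n)"
      by (simp add: power2_eq_square algebra_simps)
    then show "v \<in> (\<lambda>(a, b, c). ((a + b + c) div 3, (c - a) div 3, (b - c) div 3)) `
        {(a, b, c). a\<^sup>2 + b\<^sup>2 + c\<^sup>2 = int (3 * n)}"
      by (intro image_eqI[where x = "(s - 2 * p - t, s + p + 2 * t, s + p - t)"]) (simp_all add: v(1))
  qed
  then have fin: "finite (M n)"
    by (rule finite_subset) (intro finite_imageI finite_three_squares)
  define S where "S = (\<lambda>P. \<Sum>(s, p, t)\<in>M n. parity_sign s * of_bool (P p t))"
  have rot: "S (\<lambda>p t. P p t) = S (\<lambda>p t. P t (- p - t))" for P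
    unfolding S_def
    by (rule sum.reindex_bij_witness[of _ "\<lambda>(s, p, t). (s, t, - p - t)"
          "\<lambda>(s, p, t). (s, - p - t, p)"])
      (auto simp: M_def power2_eq_square algebra_simps)
  \<comment> \<open>Two rotations connect these classes; a single one suffices for
    \<open>O3\<close>.\<close>
  have O2: "S (\<lambda>p t. even p \<and> odd t) = S (\<lambda>p t. odd p \<and> even t)"
    by (subst (2) rot, subst (2) rot) (auto simp: S_def intro!: sum.cong)
  have O3: "S (\<lambda>p t. odd p \<and> odd t) = S (\<lambda>p t. odd p \<and> even t)"
    by (subst (2) rot) (auto simp: S_def intro!: sum.cong)
  have "(\<Sum>(s, p, t)\<in>M n. parity_sign (s + t)) =
      S (\<lambda>p t. even p \<and> even t) + S (\<lambda>p t. odd p \<and> even t)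
      - S (\<lambda>p t. even p \<and> odd t) - S (\<lambda>p t. odd p \<and> odd t)"
    unfolding S_def sum.distrib[symmetric] sum_subtractf[symmetric]
    by (intro sum.cong) (auto simp: parity_sign_def)
  also have "\<dots> = S (\<lambda>p t. even p \<and> even t) - S (\<lambda>p t. odd p \<and> even t)"
    by (simp add: O2 O3)
  \<comment> \<open>The equal nonzero classes entered with signs +, -, -, so one copy remains with
    sign -. This is the sign of p on the sublattice of even t.\<close>
  also have "\<dots> = (\<Sum>(s, p, t)\<in>M n. of_bool (even t) * parity_sign (s + p))"
    unfolding S_def sum_subtractf[symmetric] by (intro sum.cong) (auto simp: parity_sign_def)
  also have "\<dots> = (\<Sum>(s, p, t) | (s, p, t) \<in> M n \<and> even t. parity_sign (s + p))"
    by (rule sum.mono_neutral_cong_right[OF fin]) auto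
  finally show ?thesis .
qed

text \<open>Completing the square: for t = 2v and p = u - v the form p^2 + pt + t^2 becomes u^2 +
  3v^2.\<close>

lemma eisenstein_even_sum:
  "(\<Sum>(s, p, t) | s\<^sup>2 + 2 * (p\<^sup>2 + p * t + t\<^sup>2) = int n \<and> even t. parity_sign (s + p)) =
    (\<Sum>(s, u, v) | s\<^sup>2 + 2 * u\<^sup>2 + 6 * v\<^sup>2 = int n.
      parity_sign s * (parity_sign u * parity_sign v))"
proof (rule sum.reindex_bij_witness[of _ "\<lambda>(s, u, v). (s, u - v, 2 * v)"
      "\<lambda>(s, p, t). (s, p + t div 2, t div 2)"], goal_cases)
  case (5 v)
  then show ?case by (auto simp flip: parity_sign_add) (auto simp: parity_sign_def)
qed (auto simp: power2_eq_square algebra_simps elim!: evenE)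

text \<open>The last factor is \<phi>(-q^6) = y(q^3), a series in q^3. Only the restriction to
  diagonal triples is a congruence; the later changes of variables are exact.\<close>

lemma section_3_phi_neg_phi_square:
  "3 dvd fps_section 3 0 (phi_neg * phi\<^sup>2) -
    phi_neg * ((phi_neg oo fps_X\<^sup>2) * (phi_neg oo fps_X ^ 6))"
proof -
  have "3 dvd (fps_section 3 0 (phi_neg * phi\<^sup>2) -
    phi_neg * ((phi_neg oo fps_X\<^sup>2) * (phi_neg oo fps_X ^ 6))) $ n" for n
  proof -
    have "fps_section 3 0 (phi_neg * phi\<^sup>2) $ n =
        (\<Sum>(a, b, c) | a\<^sup>2 + b\<^sup>2 + c\<^sup>2 = 3 * int n. parity_sign a)"
      unfolding phi_def phi_neg_def power2_eq_square[of "lattice_theta _ _"]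
        lattice_theta_mult[OF finite_square_fibre_1 finite_square_fibre_1]
        lattice_theta_mult[OF finite_square_fibre_1
          finite_fibre_add[OF finite_square_fibre_1 finite_square_fibre_1]]
      by (auto simp: lattice_theta_def fps_section_nth nat_eq_iff_int_eq
          simp del: of_nat_eq_iff intro!: sum.cong)
    moreover have "(phi_neg * ((phi_neg oo fps_X\<^sup>2) * (phi_neg oo fps_X ^ 6))) $ n =
        (\<Sum>(s, u, v) | s\<^sup>2 + 2 * u\<^sup>2 + 6 * v\<^sup>2 = int n.
          parity_sign s * (parity_sign u * parity_sign v))"
      unfolding phi_neg_def lattice_theta_compose_X_power[OF zero_less_numeral]
        lattice_theta_mult[OF finite_square_fibre[OF zero_less_numeral]
          finite_square_fibre[OF zero_less_numeral]]
        lattice_theta_mult[OF finite_square_fibre_1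
          finite_fibre_add[OF finite_square_fibre[OF zero_less_numeral]
            finite_square_fibre[OF zero_less_numeral]]]
      by (auto simp: lattice_theta_def nat_eq_iff_int_eq
          simp del: of_nat_eq_iff intro!: sum.cong)
    ultimately show ?thesis
      using three_squares_sum_cong[of n] three_squares_diagonal_sum[of n]
        eisenstein_sign_sum[of n] eisenstein_even_sum[of n]
      by simp
  qed
  then show ?thesis by (simp only: numeral_dvd_fps_iff) simp
qed

section \<open>Gauss' identity\<close>

text \<open>Each summand is the difference of the right-hand side at s + 1 and at s. The case m = n
  supplies the induction step of the finite form of Gauss' identity.\<close>

lemma gauss_telescope:
  fixes n m :: nat
  defines "D \<equiv> \<lambda>m. \<Prod>k=1..m. (1 + fps_X ^ k :: 'a::comm_ring_1 fps)"
    and "A \<equiv> \<lambda>m. \<Prod>k=m..n. (1 - fps_X ^ k :: 'a fps)"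
  assumes "m \<le> n"
  shows "(\<Sum>s<m. (- 1) ^ s * D s * A (Suc s) * fps_X ^ (s * n) *
      (fps_X ^ s - fps_X ^ (n + 1 + s) - 1 - fps_X ^ n)) =
    (- 1) ^ m * D m * A m * fps_X ^ (m * n)"
  using assms(3)
proof (induction m)
  case 0
  \<comment> \<open>The factor with k = 0 is 1 - q^0 = 0, so the telescoping starts from 0.\<close>
  have "A 0 = 0" by (auto simp: A_def intro!: prod_zero bexI[of _ 0])
  then show ?case by simp
next
  case (Suc m)
  have A: "A m = (1 - fps_X ^ m) * A (Suc m)"
    using Suc.prems unfolding A_def by (subst prod.atLeast_Suc_atMost) auto
  have D: "D (Suc m) = D m * (1 + fps_X * fps_X ^ m)"
    by (simp add: D_def)
  show ?case
    using Suc by (simp add: A D power_add) (simp add: algebra_simps)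
qed

text \<open>All terms with s > 0 on the left-hand side are divisible by q^n, so that in the limit this
  becomes f_1 = (f_2 / f_1) \<phi>(-q).\<close>
lemma gauss_finite:
  fixes n :: nat
  defines "D \<equiv> \<lambda>m. \<Prod>k=1..m. (1 + fps_X ^ k :: 'a::comm_ring_1 fps)"
    and "A \<equiv> \<lambda>m n. \<Prod>k=m..n. (1 - fps_X ^ k :: 'a fps)"
  shows "(1 + fps_X ^ n) * (\<Sum>s<n. (- 1) ^ s * D s * A (Suc s) n * fps_X ^ (s * n)) =
    D n * (\<Sum>k<n. (- 1) ^ k * (fps_X ^ k\<^sup>2 - fps_X ^ (Suc k)\<^sup>2))"
proof (induction n)
  case 0
  show ?case by simp
next
  case (Suc n)
  let ?U = "\<lambda>n. \<Sum>s<n. (- 1) ^ s * D s * A (Suc s) n * fps_X ^ (s * n)"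
  have A: "A (Suc s) (Suc n) = A (Suc s) n * (1 - fps_X * fps_X ^ n)" if "s \<le> n" for s
    using that by (simp add: A_def)
  \<comment> \<open>Passing to n + 1 multiplies the summand s by q^s (1 - q^(n+1)). Subtracting and
    adding 1 + q^n isolates a telescoping sum and the induction hypothesis; the new summand s = n
    stands apart.\<close>
  have "?U (Suc n) = (\<Sum>s<n. (- 1) ^ s * D s * A (Suc s) n * fps_X ^ (s * n) *
        (fps_X ^ s - fps_X ^ (n + 1 + s) - 1 - fps_X ^ n)) +
      (1 + fps_X ^ n) * ?U n + (- 1) ^ n * D n * (1 - fps_X * fps_X ^ n) * fps_X ^ (n * Suc n)"
  proof -
    have "?U (Suc n) = (\<Sum>s<n. (- 1) ^ s * D s * A (Suc s) (Suc n) * fps_X ^ (s * Suc n)) +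
        (- 1) ^ n * D n * A (Suc n) (Suc n) * fps_X ^ (n * Suc n)"
      by simp
    also have "(\<Sum>s<n. (- 1) ^ s * D s * A (Suc s) (Suc n) * fps_X ^ (s * Suc n)) =
        (\<Sum>s<n. (- 1) ^ s * D s * A (Suc s) n * fps_X ^ (s * n) *
          (fps_X ^ s - fps_X ^ (n + 1 + s) - 1 - fps_X ^ n)) + (1 + fps_X ^ n) * ?U n"
      unfolding sum_distrib_left sum.distrib[symmetric]
      by (rule sum.cong) (simp_all add: A power_add algebra_simps)
    finally show ?thesis by (simp add: A_def)
  qed
  also have "\<dots> = (- 1) ^ n * D n * (1 - fps_X ^ n) * fps_X ^ (n * n) +
      (1 + fps_X ^ n) * ?U n + (- 1) ^ n * D n * (1 - fps_X * fps_X ^ n) * fps_X ^ (n * Suc n)"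
    using gauss_telescope[of n n, where 'a = 'a] by (simp add: D_def A_def)
  \<comment> \<open>The two terms with q^(n^2 + n) cancel and leave q^(n^2) - q^((n+1)^2).\<close>
  also have "\<dots> = D n * (\<Sum>k<Suc n. (- 1) ^ k * (fps_X ^ k\<^sup>2 - fps_X ^ (Suc k)\<^sup>2))"
    unfolding Suc.IH by (simp add: power2_eq_square power_add algebra_simps)
  finally have U: "?U (Suc n) = D n * (\<Sum>k<Suc n. (- 1) ^ k * (fps_X ^ k\<^sup>2 - fps_X ^ (Suc k)\<^sup>2))" .
  have D: "D (Suc n) = (1 + fps_X ^ Suc n) * D n"
    by (simp add: D_def mult.commute del: power_Suc)
  show ?case unfolding U D by (simp only: mult.assoc)
qed

section \<open>Integer series inside the rational ones, and truncations of eta products and theta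
  series\<close>

definition fps_of_int :: "int fps \<Rightarrow> rat fps" where
  "fps_of_int F = Abs_fps (\<lambda>n. of_int (F $ n))"

lemma fps_of_int_nth [simp]: "fps_of_int F $ n = of_int (F $ n)"
  by (simp add: fps_of_int_def)

lemma fps_of_int_1 [simp]: "fps_of_int 1 = 1"
  by (rule fps_ext) simp

lemma fps_of_int_mult: "fps_of_int (F * G) = fps_of_int F * fps_of_int G"
  by (rule fps_ext) (simp add: fps_mult_nth)

lemma fps_of_int_power: "fps_of_int (F ^ k) = fps_of_int F ^ k"
  by (induction k) (simp_all add: fps_of_int_mult)

lemma fps_of_int_compose_X_power:
  "k > 0 \<Longrightarrow> fps_of_int (F oo fps_X ^ k) = fps_of_int F oo fps_X ^ k"
  by (rule fps_ext) (simp add: fps_nth_compose_X_power)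

text \<open>Since k > 0, every factor with index beyond j differs from 1 only above exponent
  j.\<close>

lemma prod_eta_nth_stable:
  fixes k :: nat
  assumes "k > 0" "j \<le> m"
  shows "(\<Prod>n=1..m. (1 - fps_X ^ (k * n) :: rat fps)) $ j = eta_f k $ j"
  using assms(2)
proof (induction m rule: dec_induct)
  case base
  show ?case by (simp add: eta_f_def)
next
  case (step m)
  have "j < k * Suc m" using assms(1) step.hyps by (cases k) auto
  then show ?case
    using step.IH by (simp add: right_diff_distrib fps_X_power_mult_right_nth del: mult_Suc_right)
qed

lemma fps_X_power_dvd_eta_diff:
  "k > 0 \<Longrightarrow> fps_X ^ Suc m dvd eta_f k - (\<Prod>n=1..m. (1 - fps_X ^ (k * n)))"
  by (simp add: fps_X_power_dvd_iff prod_eta_nth_stable del: power_Suc One_nat_def)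

lemma eta_f_compose_X_power:
  assumes "j > 0" "k > 0"
  shows "eta_f k oo fps_X ^ j = eta_f (j * k)"
proof (rule fps_ext)
  fix n
  have "eta_f (j * k) $ n = (\<Prod>i=1..n. (1 - fps_X ^ (k * i)) oo fps_X ^ j) $ n"
    using assms by (simp add: eta_f_def fps_compose_sub_distrib fps_X_power_compose
        mult.assoc del: One_nat_def flip: power_mult)
  also have "\<dots> = ((\<Prod>i=1..n. (1 - fps_X ^ (k * i))) oo fps_X ^ j) $ n"
    using assms by (subst fps_compose_prod_distrib) auto
  also have "\<dots> = (eta_f k oo fps_X ^ j) $ n"
    using assms by (simp add: fps_nth_compose_X_power prod_eta_nth_stable del: One_nat_def)
  finally show "(eta_f k oo fps_X ^ j) $ n = eta_f (j * k) $ n" by simp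
qed

text \<open>The summand k collects the integers -k and k + 1, which have opposite signs. For k < n
  these exhaust the interval from 1 - n to n, which contains every root of a square below n.\<close>

lemma phi_neg_cong_partial_sum:
  "fps_X ^ n dvd fps_of_int phi_neg - (\<Sum>k<n. (- 1) ^ k * (fps_X ^ k\<^sup>2 - fps_X ^ (Suc k)\<^sup>2))"
  unfolding fps_X_power_dvd_iff
proof (intro allI impI)
  fix j assume "j < n"
  have neg1: "(- 1) ^ k = (fps_const ((- 1) ^ k) :: rat fps)" for k
    by (simp flip: fps_const_power fps_const_neg)
  define f where "f = (\<lambda>a::int. if a\<^sup>2 = int j then parity_sign a else 0)"
  have "{a::int. a\<^sup>2 = int j} \<subseteq> {1 - int n..int n}"
  proof
    fix a :: int assume "a \<in> {a. a\<^sup>2 = int j}"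
    moreover have "\<bar>a\<bar> \<le> a\<^sup>2"
      by (rule abs_le_square)
    ultimately show "a \<in> {1 - int n..int n}" using \<open>j < n\<close> by auto
  qed
  then have "phi_neg $ j = (\<Sum>a\<in>{1 - int n..int n}. f a)"
    unfolding phi_neg_def lattice_theta_def f_def
    by (simp add: nat_square_eq_iff) (intro sum.mono_neutral_cong_left, auto)
  also have "{1 - int n..int n} = (\<lambda>k. - int k) ` {..<n} \<union> (\<lambda>k. int (Suc k)) ` {..<n}"
  proof (intro equalityI subsetI)
    fix a assume a: "a \<in> {1 - int n..int n}"
    show "a \<in> (\<lambda>k. - int k) ` {..<n} \<union> (\<lambda>k. int (Suc k)) ` {..<n}"
    proof (cases "a \<le> 0")
      case True
      then show ?thesis using a by (intro UnI1 image_eqI[of _ _ "nat (- a)"]) auto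
    next
      case False
      then show ?thesis using a by (intro UnI2 image_eqI[of _ _ "nat (a - 1)"]) auto
    qed
  qed auto
  also have "sum f \<dots> = (\<Sum>k<n. f (- int k)) + (\<Sum>k<n. f (int (Suc k)))"
    by (subst sum.union_disjoint) (auto simp: sum.reindex inj_on_def)
  finally have "fps_of_int phi_neg $ j = (\<Sum>k<n. of_int (f (- int k) + f (int (Suc k))))"
    by (simp add: sum.distrib)
  also have "\<dots> = (\<Sum>k<n. ((- 1) ^ k * (fps_X ^ k\<^sup>2 - fps_X ^ (Suc k)\<^sup>2)) $ j)"
  proof (rule sum.cong)
    fix k
    have "(int k)\<^sup>2 = int j \<longleftrightarrow> j = k\<^sup>2" "(int (Suc k))\<^sup>2 = int j \<longleftrightarrow> j = (Suc k)\<^sup>2"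
      by (metis of_nat_eq_iff of_nat_power)+
    then show "of_int (f (- int k) + f (int (Suc k))) =
        ((- 1) ^ k * (fps_X ^ k\<^sup>2 - fps_X ^ (Suc k)\<^sup>2) :: rat fps) $ j"
      unfolding neg1 by (auto simp: f_def parity_sign_def simp del: of_nat_Suc)
  qed simp
  finally show "(fps_of_int phi_neg -
      (\<Sum>k<n. (- 1) ^ k * (fps_X ^ k\<^sup>2 - fps_X ^ (Suc k)\<^sup>2))) $ j = 0"
    by (simp add: fps_sum_nth)
qed

text \<open>Modulo q^n, for each n > 0: f_1 is a, f_2 is a \<open>D n\<close>, \<phi>(-q) is
  \<open>G\<close>, and the finite identity gives a = \<open>D n\<close> \<open>G\<close>.
  Multiplication by a yields the claim.\<close>

lemma gauss_eta_identity: "eta_f 1 ^ 2 = eta_f 2 * fps_of_int phi_neg"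
proof -
  have "fps_X ^ n dvd eta_f 1 ^ 2 - eta_f 2 * fps_of_int phi_neg" if "n > 0" for n
  proof -
    define D where "D = (\<lambda>m. \<Prod>k=1..m. (1 + fps_X ^ k :: rat fps))"
    define A where "A = (\<lambda>m n. \<Prod>k=m..n. (1 - fps_X ^ k :: rat fps))"
    define a where "a = A 1 n"
    define G where "G = (\<Sum>k<n. (- 1) ^ k * (fps_X ^ k\<^sup>2 - fps_X ^ (Suc k)\<^sup>2 :: rat fps))"
    define U where "U = (\<Sum>s<n. (- 1) ^ s * D s * A (Suc s) n * fps_X ^ (s * n))"
    have U: "(1 + fps_X ^ n) * U = D n * G"
      using gauss_finite[of n, where 'a = rat] by (simp add: U_def D_def A_def G_def)
    \<comment> \<open>Only the term s = 0 survives modulo q^n.\<close>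
    have "U = a + (\<Sum>s=1..<n. (- 1) ^ s * D s * A (Suc s) n * fps_X ^ (s * n))"
      unfolding U_def lessThan_atLeast0
      by (subst sum.atLeast_Suc_lessThan) (simp_all add: that D_def a_def)
    moreover have "fps_X ^ n dvd (\<Sum>s=1..<n. (- 1) ^ s * D s * A (Suc s) n * fps_X ^ (s * n))"
      by (rule dvd_sum) (auto intro!: dvd_mult le_imp_power_dvd)
    ultimately obtain u where u: "U = a + fps_X ^ n * u" by (auto elim: dvdE)
    have "a * D n = (\<Prod>k=1..n. (1 - fps_X ^ (2 * k)))"
      unfolding a_def A_def D_def prod.distrib[symmetric]
      by (simp add: algebra_simps mult_2_right power_add)
    then have "fps_X ^ Suc n dvd eta_f 1 - a" "fps_X ^ Suc n dvd eta_f 2 - a * D n"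
      using fps_X_power_dvd_eta_diff[of 1 n] fps_X_power_dvd_eta_diff[of 2 n]
      by (simp_all add: a_def A_def)
    then obtain e1 e2 where "eta_f 1 = a + fps_X ^ n * e1" "eta_f 2 = a * D n + fps_X ^ n * e2"
      by (auto elim!: dvdE simp: algebra_simps)
    moreover obtain p where "fps_of_int phi_neg = G + fps_X ^ n * p"
      using phi_neg_cong_partial_sum[of n] by (auto elim!: dvdE simp: G_def algebra_simps)
    ultimately have "eta_f 1 ^ 2 - eta_f 2 * fps_of_int phi_neg =
        a\<^sup>2 - a * (D n * G) + fps_X ^ n * (2 * a * e1 + fps_X ^ n * e1\<^sup>2
          - a * D n * p - e2 * (G + fps_X ^ n * p))"
      by (simp add: power2_eq_square algebra_simps)
    also have "a\<^sup>2 - a * (D n * G) = fps_X ^ n * (- a\<^sup>2 - a * u - a * fps_X ^ n * u)"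
      unfolding U[symmetric] u by (simp add: power2_eq_square algebra_simps)
    finally show ?thesis by (simp flip: distrib_left)
  qed
  then have "(eta_f 1 ^ 2 - eta_f 2 * fps_of_int phi_neg) $ j = 0" for j
    using fps_X_power_dvd_iff[of "Suc j"] by blast
  then show ?thesis by (simp add: fps_eq_iff)
qed

section \<open>Divisibility of the coefficients\<close>

lemma eta_f_nth_0: "eta_f k $ 0 = 1"
  by (simp add: eta_f_def)

text \<open>Gauss' identity at q and at q^2 gives f_1^2 = f_2 x and f_2^2 = f_4 y, which turn the
  denominator into f_4^(c-1) x y^(c-1). The inverse \<open>G\<close> is taken over the integers so
  that its coefficients can be reduced modulo 3 and 4.\<close>

lemma overcubic_gf_eq:
  assumes "c > 1" and G: "G * (phi_neg * (phi_neg oo fps_X\<^sup>2) ^ (c - 1)) = 1"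
  shows "overcubic_gf c = fps_of_int G"
proof -
  define x y where "x = fps_of_int phi_neg" and "y = fps_of_int (phi_neg oo fps_X\<^sup>2)"
  have 1: "eta_f 1 ^ 2 = eta_f 2 * x"
    unfolding x_def by (rule gauss_eta_identity)
  then have "(eta_f 1 ^ 2) oo fps_X\<^sup>2 = (eta_f 2 * x) oo fps_X\<^sup>2" by simp
  then have 2: "eta_f 2 ^ 2 = eta_f 4 * y"
    using eta_f_compose_X_power[of 2 1] eta_f_compose_X_power[of 2 2]
    by (simp add: fps_compose_mult_distrib fps_compose_power[symmetric] x_def y_def
        fps_of_int_compose_X_power)
  have inv: "inverse f * f = 1" if "f $ 0 = 1" for f :: "rat fps"
    using that by (simp add: inverse_mult_eq_1)
  \<comment> \<open>For c > 1 this removes the truncated subtractions in the exponents.\<close>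
  define d where "d = c - 2"
  have c: "c - 1 = Suc d" "2 * c - 3 = 2 * d + 1" using assms(1) by (auto simp: d_def)
  let ?E = "eta_f 1 ^ 2 * eta_f 2 ^ (2 * d + 1)"
  have E: "?E = eta_f 4 ^ Suc d * (x * y ^ Suc d)"
  proof -
    have "?E = eta_f 1 ^ 2 * eta_f 2 * (eta_f 2 ^ 2) ^ d"
      by (simp only: power_add power_one_right mult_ac flip: power_mult)
    also have "\<dots> = eta_f 2 ^ 2 * x * (eta_f 2 ^ 2) ^ d"
      unfolding 1 by (simp only: power2_eq_square mult_ac)
    also have "\<dots> = eta_f 4 ^ Suc d * (x * y ^ Suc d)"
      unfolding 2 by (simp add: power_mult_distrib mult_ac)
    finally show ?thesis .
  qed
  have E0: "?E $ 0 = 1" by (simp add: eta_f_nth_0 fps_nth_power_0)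
  have G': "fps_of_int G * (x * y ^ Suc d) = 1"
    using arg_cong[OF G[unfolded c], of fps_of_int]
    by (simp only: fps_of_int_mult fps_of_int_power fps_of_int_1 x_def y_def)
  have "overcubic_gf c = eta_f 4 ^ Suc d * inverse ?E"
    using assms(1) unfolding overcubic_gf_def c by simp
  also have "\<dots> = eta_f 4 ^ Suc d * inverse ?E * (fps_of_int G * (x * y ^ Suc d))"
    by (simp only: G' mult_1_right)
  also have "\<dots> = fps_of_int G * (inverse ?E * (eta_f 4 ^ Suc d * (x * y ^ Suc d)))"
    by (simp only: mult_ac)
  also have "\<dots> = fps_of_int G"
    unfolding E[symmetric] inv[OF E0] by simp
  finally show ?thesis .
qed

section \<open>Exponents that are not squares, and sections of theta series\<close>

lemma square_ne_9n_6: "(a::int)\<^sup>2 \<noteq> int (9 * n + 6)"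
proof
  assume a: "a\<^sup>2 = int (9 * n + 6)"
  then have "a\<^sup>2 mod 3 = 0" by simp
  then have "3 dvd a" by (simp add: square_mod_3 split: if_splits)
  then obtain b where "a = 3 * b" by blast
  with a have "9 * b\<^sup>2 = 9 * int n + 6" by simp
  then show False by presburger
qed

lemma double_square_ne_9n_6: "2 * (a::int)\<^sup>2 \<noteq> int (9 * n + 6)"
proof
  assume a: "2 * a\<^sup>2 = int (9 * n + 6)"
  then have "a\<^sup>2 mod 3 = 0" by simp presburger
  then have "3 dvd a" by (simp add: square_mod_3 split: if_splits)
  then obtain b where "a = 3 * b" by blast
  with a have "18 * b\<^sup>2 = 9 * int n + 6" by simp
  then show False by presburger
qed

lemma square_ne_3n_2: "(a::int)\<^sup>2 \<noteq> int (3 * n + 2)"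
proof
  assume "a\<^sup>2 = int (3 * n + 2)"
  then have "a\<^sup>2 mod 3 = 2" by simp
  then show False by (simp add: square_mod_3 split: if_splits)
qed

lemma section_section_nth:
  "fps_section 3 2 (fps_section 3 0 G) $ n = G $ (9 * n + 6)"
  by (simp add: fps_section_nth algebra_simps)

lemma section_3_2_phi: "fps_section 3 2 phi = 0" "fps_section 3 2 phi_neg = 0"
  by (rule fps_ext, simp only: fps_section_nth fps_zero_nth phi_nth_eq_0[OF square_ne_3n_2])+

lemma section_9_6_phi: "fps_section 3 2 (fps_section 3 0 phi) = 0"
  by (rule fps_ext, simp only: section_section_nth fps_zero_nth phi_nth_eq_0[OF square_ne_9n_6])

text \<open>As -1 is not a square modulo 3, a sum of two squares divisible by 3 has both roots
  divisible by 3. Dividing them by 3 keeps their parities, so this identity is exact.\<close>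

lemma section_3_phi_neg_square:
  "fps_section 3 0 (phi_neg\<^sup>2) = phi_neg\<^sup>2 oo fps_X ^ 3"
proof (rule fps_ext)
  fix n
  have sq: "(phi_neg\<^sup>2) $ m = (\<Sum>(a, b) | a\<^sup>2 + b\<^sup>2 = int m. parity_sign a * parity_sign b)" for m
    unfolding phi_neg_def power2_eq_square[of "lattice_theta _ _"]
      lattice_theta_mult[OF finite_square_fibre_1 finite_square_fibre_1]
    by (auto simp: lattice_theta_def nat_eq_iff_int_eq simp del: of_nat_eq_iff intro!: sum.cong)
  have dvd: "3 dvd a \<and> 3 dvd b" if "a\<^sup>2 + b\<^sup>2 = 3 * int n" for a b
  proof -
    have "(a\<^sup>2 mod 3 + b\<^sup>2 mod 3) mod 3 = (a\<^sup>2 + b\<^sup>2) mod 3" by (simp add: mod_simps)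
    also have "\<dots> = 0" using that by simp
    finally show ?thesis by (auto simp: square_mod_3 split: if_splits)
  qed
  show "fps_section 3 0 (phi_neg\<^sup>2) $ n = (phi_neg\<^sup>2 oo fps_X ^ 3) $ n"
  proof (cases "3 dvd n")
    case True
    then obtain m where m: "n = 3 * m" by blast
    have "(\<Sum>(a, b) | a\<^sup>2 + b\<^sup>2 = int (3 * n). parity_sign a * parity_sign b) =
        (\<Sum>(a, b) | a\<^sup>2 + b\<^sup>2 = int m. parity_sign a * parity_sign b)"
    proof -
      have "{(a, b). a\<^sup>2 + b\<^sup>2 = int (3 * n)} =
          (\<lambda>(a, b). (3 * a, 3 * b)) ` {(a, b). a\<^sup>2 + b\<^sup>2 = int m}"
      proof (intro equalityI subsetI)
        fix v assume "v \<in> {(a, b). a\<^sup>2 + b\<^sup>2 = int (3 * n)}"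
        then obtain a b where v: "v = (a, b)" "a\<^sup>2 + b\<^sup>2 = 3 * int n" by auto
        then obtain a' b' where "a = 3 * a'" "b = 3 * b'" using dvd by (metis dvdE)
        then show "v \<in> (\<lambda>(a, b). (3 * a, 3 * b)) ` {(a, b). a\<^sup>2 + b\<^sup>2 = int m}"
          using v m by (intro image_eqI[of _ _ "(a', b')"]) auto
      qed (auto simp: m)
      then show ?thesis
        by (simp only: sum.reindex inj_on_def)
          (subst sum.reindex, auto simp: inj_on_def parity_sign_def intro!: sum.cong)
    qed
    then show ?thesis using m by (simp add: fps_section_nth fps_nth_compose_X_power sq)
  next
    case False
    have "a\<^sup>2 + b\<^sup>2 \<noteq> 3 * int n" for a b
    proof
      assume eq: "a\<^sup>2 + b\<^sup>2 = 3 * int n"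
      then obtain a' b' where "a = 3 * a'" "b = 3 * b'" using dvd by (metis dvdE)
      then have "9 * (a'\<^sup>2 + b'\<^sup>2) = 3 * int n" using eq by simp
      then have "int n = 3 * (a'\<^sup>2 + b'\<^sup>2)" by simp
      then have "int 3 dvd int n" by (metis dvd_triv_left of_nat_numeral)
      then show False using False by (simp only: int_dvd_int_iff)
    qed
    then show ?thesis using False by (simp add: fps_section_nth fps_nth_compose_X_power sq)
  qed
qed

text \<open>The second extraction: 9n + 6 = 3(3n + 2), so the class 2 is taken after the class 0. It
  annihilates F, and the remaining factor f is a unit.\<close>

lemma three_dvd_coeff:
  assumes "3 dvd fps_section 3 0 G * f ^ 3 - F" "fps_section 3 2 F = 0" "f $ 0 = 1"
  shows "(3::int) dvd G $ (9 * n + 6)"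
proof -
  have "3 dvd fps_section 3 2 (fps_section 3 0 G) * f"
    using cong_cube_section[OF assms(1), of 2] assms(2) by simp
  then have "3 dvd fps_section 3 2 (fps_section 3 0 G)"
    by (rule dvd_mult_fps_unit_cancel) fact
  then show ?thesis by (simp only: numeral_dvd_fps_iff section_section_nth)
qed

section \<open>Divisibility by 4\<close>

lemma phi_neg_cong_1_mod_2: "2 dvd phi_neg - 1"
proof -
  have "2 dvd (phi_neg - 1) $ n" for n
  proof (cases "n = 0")
    case False
    let ?S = "{a. a\<^sup>2 = int n}"
    have fin: "finite ?S"
      using finite_square_fibre_1[of n] by (simp add: nat_square_eq_iff)
    have "phi_neg $ n = sum parity_sign {a \<in> ?S. True}"
      by (simp add: phi_neg_def lattice_theta_def nat_square_eq_iff)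
    also have "\<dots> = sum parity_sign {a \<in> ?S. a > 0} + sum parity_sign {a \<in> ?S. \<not> a > 0}"
      by (subst sum_filter_split[OF fin, where R = "\<lambda>a. a > 0"]) simp
    \<comment> \<open>For n > 0 the roots come in pairs a, -a of equal sign.\<close>
    also have "sum parity_sign {a \<in> ?S. \<not> a > 0} = sum parity_sign {a \<in> ?S. a > 0}"
      by (rule sum.reindex_bij_witness[of _ uminus uminus])
        (use False in \<open>auto simp: not_less le_less\<close>)
    finally show ?thesis using False by simp
  qed simp
  then show ?thesis unfolding numeral_dvd_fps_iff by blast
qed

lemma four_dvd_coeff:
  assumes G: "G * (phi_neg * (phi_neg oo fps_X\<^sup>2) ^ k) = 1"
  shows "4 dvd G $ (9 * n + 6)"
proof -
  define x y where "x = phi_neg" and "y = phi_neg oo fps_X\<^sup>2"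
  obtain P where P: "x = 1 + 2 * P"
    using phi_neg_cong_1_mod_2 by (auto elim!: dvdE simp: x_def algebra_simps)
  define R where "R = P oo fps_X\<^sup>2"
  have R: "y = 1 + 2 * R"
  proof -
    have "y = (1 + 2 * P) oo fps_X\<^sup>2" by (simp only: y_def x_def flip: P)
    also have "\<dots> = 1 + 2 * R"
      by (simp add: R_def fps_compose_add_distrib fps_compose_mult_distrib)
    finally show ?thesis .
  qed
  have "x\<^sup>2 - 1 = 4 * (P + P\<^sup>2)" "y\<^sup>2 - 1 = 4 * (R + R\<^sup>2)"
    by (simp_all add: P R power2_eq_square algebra_simps)
  then have x2: "4 dvd x\<^sup>2 - 1" and y2: "4 dvd y\<^sup>2 - 1" by simp_all
  have ypow: "4 dvd (y\<^sup>2) ^ l - 1" for l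
  proof (induction l)
    case (Suc l)
    have "(y\<^sup>2) ^ Suc l - 1 = y\<^sup>2 * ((y\<^sup>2) ^ l - 1) + (y\<^sup>2 - 1)" by (simp add: algebra_simps)
    then show ?case using Suc y2 by (metis dvd_add dvd_mult)
  qed simp
  \<comment> \<open>Modulo 4 the series x y^k is its own inverse, hence congruent to
    \<open>G\<close>.\<close>
  have "x * y ^ k - G = G * ((x\<^sup>2 - 1) * (y\<^sup>2) ^ k + ((y\<^sup>2) ^ k - 1))"
  proof -
    have "x * y ^ k = G * (x * y ^ k) * (x * y ^ k)" using G by (simp add: x_def y_def)
    then show ?thesis
      by (simp add: algebra_simps power2_eq_square power_mult_distrib)
  qed
  then have G1: "4 dvd x * y ^ k - G" using x2 ypow[of k] by (metis dvd_add dvd_mult dvd_mult2)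
  have x0: "x $ (9 * n + 6) = 0"
    unfolding x_def by (rule phi_nth_eq_0(2)[OF square_ne_9n_6])
  have y0: "y $ (9 * n + 6) = 0"
  proof (cases "even (9 * n + 6)")
    case True
    then obtain m where m: "9 * n + 6 = 2 * m" by blast
    have "a\<^sup>2 \<noteq> int m" for a :: int
      using double_square_ne_9n_6[of a n] by (simp add: m)
    then show ?thesis
      unfolding y_def by (simp add: m fps_nth_compose_X_power phi_nth_eq_0(2))
  next
    case False
    then show ?thesis unfolding y_def by (simp only: fps_nth_compose_X_power zero_less_numeral if_False)
  qed
  obtain H where H: "4 dvd x * y ^ k - H" "H $ (9 * n + 6) = 0"
  proof (cases "even k")
    case True
    then obtain l where "k = 2 * l" by blast
    then have "4 dvd y ^ k - 1" using ypow[of l] by (simp add: power_mult)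
    then have "4 dvd x * (y ^ k - 1)" by (rule dvd_mult)
    then show ?thesis using x0 by (intro that[of x]) (simp_all add: algebra_simps)
  next
    case False
    then obtain l where "k = 2 * l + 1" by (blast elim: oddE)
    \<comment> \<open>Both x - 1 and y - 1 are even, so modulo 4 the product xy linearizes to x + y
      - 1.\<close>
    then have "x * y ^ k - (x + y - 1) = x * y * ((y\<^sup>2) ^ l - 1) + (x - 1) * (y - 1)"
      by (simp add: algebra_simps flip: power_mult)
    moreover have "(x - 1) * (y - 1) = 4 * (P * R)" by (simp add: P R)
    ultimately have "4 dvd x * y ^ k - (x + y - 1)"
      using ypow[of l] by (metis dvd_add dvd_mult dvd_triv_left)
    then show ?thesis using x0 y0 by (intro that[of "x + y - 1"]) simp_all
  qed
  have "4 dvd G - H"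
    using dvd_diff[OF H(1) G1] by simp
  then have "4 dvd (G - H) $ (9 * n + 6)" by (simp only: numeral_dvd_fps_iff)
  then show ?thesis using H(2) by simp
qed

section \<open>Divisibility by 3 for c congruent to 8, 4 and 0 modulo 9\<close>

context
  fixes G x y :: "int fps" and i :: nat
  defines "x \<equiv> phi_neg" and "y \<equiv> phi_neg oo fps_X\<^sup>2"
begin

text \<open>Two more factors y complete the exponent c - 1 = 9i + 7 to 9(i + 1) and contribute xz.
  The power of y is a ninth power, so it is still a cube after the first extraction.\<close>

lemma three_dvd_coeff_c_mod_9_eq_8:
  assumes G: "G * (x * y ^ (9 * i + 7)) = 1"
  shows "3 dvd G $ (9 * n + 6)"
proof -
  have "G * (y ^ (3 * (i + 1))) ^ 3 = G * (x * y ^ (9 * i + 7)) * phi"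
  proof -
    have "(y ^ (3 * (i + 1))) ^ 3 = y\<^sup>2 * y ^ (9 * i + 7)"
      by (simp flip: power_mult power_add)
    then show ?thesis by (simp add: x_def y_def mult_ac flip: phi_mult_phi_neg)
  qed
  then have "3 dvd G * (y ^ (3 * (i + 1))) ^ 3 - phi" using G by simp
  then have "3 dvd fps_section 3 0 G * (y ^ (i + 1)) ^ 3 - fps_section 3 0 phi"
    using cong_cube_section[of G "y ^ (3 * (i + 1))" phi 0]
    by (simp only: mult.commute[of 3 "i + 1"] power_mult)
  then show ?thesis
    by (rule three_dvd_coeff) (simp_all add: section_9_6_phi y_def fps_nth_power_0)
qed

text \<open>After the first extraction the factor x y^(3i+1) is not visibly a cube. Multiplication
  by z replaces x by y^2 and completes the exponent to 3(i + 1), leaving z times a series in q^3 on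
  the other side.\<close>

lemma three_dvd_coeff_c_mod_9_eq_4:
  assumes G: "G * (x * y ^ (9 * i + 3)) = 1"
  shows "3 dvd G $ (9 * n + 6)"
proof -
  have "G * (x * y ^ (3 * i + 1)) ^ 3 = G * (x * y ^ (9 * i + 3)) * x\<^sup>2"
  proof -
    have "(y ^ (3 * i + 1)) ^ 3 = y ^ (9 * i + 3)"
      by (simp only: add_mult_distrib flip: power_mult) simp
    then show ?thesis
      unfolding power_mult_distrib by (simp only: power3_eq_cube power2_eq_square mult_ac)
  qed
  then have "3 dvd G * (x * y ^ (3 * i + 1)) ^ 3 - x\<^sup>2" using G by simp
  then have "3 dvd fps_section 3 0 G * (x * y ^ (3 * i + 1)) - (x\<^sup>2 oo fps_X ^ 3)"
    using cong_cube_section[of G _ "x\<^sup>2" 0] by (simp add: x_def section_3_phi_neg_square)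
  then have "3 dvd (fps_section 3 0 G * (x * y ^ (3 * i + 1)) - (x\<^sup>2 oo fps_X ^ 3)) * phi"
    by (rule dvd_mult2)
  also have "(fps_section 3 0 G * (x * y ^ (3 * i + 1)) - (x\<^sup>2 oo fps_X ^ 3)) * phi =
      fps_section 3 0 G * (y ^ (i + 1)) ^ 3 - phi * (x\<^sup>2 oo fps_X ^ 3)"
  proof -
    have "(y ^ (i + 1)) ^ 3 = y\<^sup>2 * y ^ (3 * i + 1)"
      unfolding power_mult[symmetric] power_add[symmetric]
      by (rule arg_cong[of _ _ "(^) y"]) simp
    also have "y\<^sup>2 = x * phi" by (simp add: x_def y_def phi_mult_phi_neg)
    finally show ?thesis by (simp add: algebra_simps)
  qed
  finally show ?thesis
    by (rule three_dvd_coeff)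
      (simp_all add: section_3_2_phi fps_section_mult_compose y_def fps_nth_power_0)
qed

text \<open>Here c = 9(i + 1). Four more factors y contribute (xz)^2, and the x in the denominator
  leaves x z^2. After the first extraction a common factor y cancels, so that y^(3i+4) becomes the
  cube of y^(i+1).\<close>

lemma three_dvd_coeff_c_mod_9_eq_0:
  assumes G: "G * (x * y ^ (9 * i + 8)) = 1"
  shows "3 dvd G $ (9 * n + 6)"
proof -
  let ?y3 = "phi_neg oo fps_X ^ 6"
  have y2: "y\<^sup>2 = x * phi" by (simp add: x_def y_def phi_mult_phi_neg)
  have "G * (y ^ (3 * i + 4)) ^ 3 = G * (x * y ^ (9 * i + 8)) * (x * phi\<^sup>2)"
  proof -
    have "(y ^ (3 * i + 4)) ^ 3 = y ^ (9 * i + 8) * (y\<^sup>2 * y\<^sup>2)"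
      by (simp add: add.commute flip: power_mult power_add)
    then show ?thesis unfolding y2 by (simp only: power2_eq_square mult_ac)
  qed
  then have "3 dvd G * (y ^ (3 * i + 4)) ^ 3 - x * phi\<^sup>2" using G by simp
  then have "3 dvd fps_section 3 0 G * y ^ (3 * i + 4) - fps_section 3 0 (x * phi\<^sup>2)"
    using cong_cube_section[of G _ "x * phi\<^sup>2" 0] by simp
  then have "3 dvd (fps_section 3 0 G * y ^ (3 * i + 4) - fps_section 3 0 (x * phi\<^sup>2)) +
      (fps_section 3 0 (x * phi\<^sup>2) - x * (y * ?y3))"
    using section_3_phi_neg_phi_square by (intro dvd_add) (simp_all add: x_def y_def)
  also have "\<dots> = (fps_section 3 0 G * (y ^ (i + 1)) ^ 3 - x * ?y3) * y"
  proof -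
    have "y ^ (3 * i + 4) = (y ^ (i + 1)) ^ 3 * y"
      by (simp add: algebra_simps flip: power_mult power_Suc)
    then show ?thesis by (simp add: algebra_simps)
  qed
  finally have "3 dvd fps_section 3 0 G * (y ^ (i + 1)) ^ 3 - x * ?y3"
    by (rule dvd_mult_fps_unit_cancel) (simp add: y_def)
  moreover have "?y3 = y oo fps_X ^ 3"
    by (simp add: y_def fps_compose_assoc[symmetric] fps_X_power_compose flip: power_mult)
  ultimately show ?thesis
    by (intro three_dvd_coeff[of G "y ^ (i + 1)" "x * ?y3"])
      (simp_all add: section_3_2_phi fps_section_mult_compose x_def y_def fps_nth_power_0)
qed

end

lemma abar_dvd_12:
  assumes "c > 1"
    and "\<And>G. G * (phi_neg * (phi_neg oo fps_X\<^sup>2) ^ (c - 1)) = 1 \<Longrightarrow> 3 dvd G $ (9 * n + 6)"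
  shows "\<exists>m::int. abar c (9 * n + 6) = of_int (12 * m)"
proof -
  let ?F = "phi_neg * (phi_neg oo fps_X\<^sup>2) ^ (c - 1)"
  \<comment> \<open>The constant coefficient of \<open>?F\<close> is 1, so the inverse has integer
    coefficients.\<close>
  have G: "fps_left_inverse ?F 1 * ?F = 1" (is "?G * _ = _")
    by (rule fps_left_inverse) (simp add: fps_nth_power_0)
  have "4 dvd ?G $ (9 * n + 6)" by (rule four_dvd_coeff[OF G])
  moreover have "3 dvd ?G $ (9 * n + 6)" by (rule assms(2)[OF G])
  ultimately have "12 dvd ?G $ (9 * n + 6)" by presburger
  then obtain m where "?G $ (9 * n + 6) = 12 * m" by blast
  then have "abar c (9 * n + 6) = of_int (12 * m)"
    unfolding abar_def overcubic_gf_eq[OF assms(1) G] fps_of_int_nth by simp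
  then show ?thesis by blast
qed

theorem theorem1p9:
  fixes n i :: nat
  assumes "i \<ge> 1"
  shows "(\<exists>m::int. abar (9 * i) (9 * n + 6) = of_int (12 * m))
       \<and> (\<exists>m::int. abar (9 * i + 4) (9 * n + 6) = of_int (12 * m))
       \<and> (\<exists>m::int. abar (9 * i + 8) (9 * n + 6) = of_int (12 * m))"
proof (intro conjI abar_dvd_12)
  fix G :: "int fps"
  \<comment> \<open>The lemma for c divisible by 9 counts from c = 9, so it is applied to i - 1;
    this uses i \<ge> 1.\<close>
  have "9 * i - 1 = 9 * (i - 1) + 8" using assms by simp
  then show "3 dvd G $ (9 * n + 6)"
    if "G * (phi_neg * (phi_neg oo fps_X\<^sup>2) ^ (9 * i - 1)) = 1"
    using three_dvd_coeff_c_mod_9_eq_0[of G "i - 1" n] that by simp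
  show "3 dvd G $ (9 * n + 6)"
    if "G * (phi_neg * (phi_neg oo fps_X\<^sup>2) ^ (9 * i + 4 - 1)) = 1"
    using three_dvd_coeff_c_mod_9_eq_4[of G i n] that by (simp add: add.commute)
  show "3 dvd G $ (9 * n + 6)"
    if "G * (phi_neg * (phi_neg oo fps_X\<^sup>2) ^ (9 * i + 8 - 1)) = 1"
    using three_dvd_coeff_c_mod_9_eq_8[of G i n] that by (simp add: add.commute)
qed (use assms in auto)

end
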